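(* Let $K\ge1$ and $\overline T\ge1$ be integers, and consider an instance of the HSD problem with maximum parameter value $\overline T$, given by costs $c_0,\dots,c_K>0$ and acceptance rates $\alpha_{i,j}\in[0,1]$. Let $G$ be the directed graph with source vertex $(\mathcal M_K)$, edge multipliers $\mu$ and edge costs $c$ constructed from this instance as in the context. Then an augmented path in $G$ starting at $(\mathcal M_K)$ is a solution (optimal) of the Generalized Shortest Path instance $(G,\mu,c,(\mathcal M_K))$ if and only if the hierarchy $(\sigma,T)$ corresponding to the path is an optimal solution of the HSD problem.
   Context: HSD problem (with maximum parameter value $\overline T$). Models $\mathcal M_0,\dots,\mathcal M_K$ have costs $c_i>0$ and pairwise acceptance rates $\alpha_{i,j}$; $\mathcal M_K$ is the target model. A hierarchy is a pair $(\sigma,T)$ with $\sigma=(\sigma[0]<\dots<\sigma[m])$ an ordered subset of $\{0,\dots,K\}$, $m\ge1$, $\sigma[m]=K$, and $T=(T_0,\dots,T_{m-1})\in\{1,\dots,\overline T\}^m$. Its latency is $$L(\sigma,T)=\sum_{i=0}^{m} c_{\sigma[i]}\prod_{j=i}^{m} R_{j},\quad R_m=\frac{1-\alpha}{1-\alpha^{T_{m-1}+1}}\ \text{with } \alpha=\alpha_{\sigma[m-1],\sigma[m]},\quad R_j=\gamma(\alpha_{\sigma[j-1],\sigma[j]},T_{j-1},T_j)\ (1\le j<m),\quad R_0=T_0.$$ The HSD problem asks for a hierarchy minimizing $L(\sigma,T)$. For $\alpha=1$, $(1-\alpha)/(1-\alpha^{t+1})$ is read as $1/(t+1)$. For $\alpha\in[0,1]$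 and positive integers $a,b$, $\gamma(\alpha,a,b)=\mathbb E[\min\{r\ge1: N_1+\dots+N_r\ge b\}]$, where $N_1,N_2,\dots$ are i.i.d. copies of $1+G$ and $G$ is the number of successes before the first failure among $a$ independent trials of success probability $\alpha$ (so $\mathbb P(G\ge g)=\alpha^g$ for $0\le g\le a$). Generalized Shortest Path (GSP) problem. Given a directed graph $(V,E)$, multipliers $\mu:E\to\mathbb R_{>0}$, costs $c:E\to\mathbb R$ and a source $s\in V$, minimize $\sum_{e\in E}f(e)c(e)$ over $f:E\to\mathbb R_{\ge0}$ satisfying, for all $v\in V$, $\sum_{(v,w)\in E}f(v,w)-\sum_{(u,v)\in E}\mu(u,v)f(u,v)=\mathbb I[v=s]$. A lossy cycle is a cycle whose product of multipliers is $<1$. An augmented path is a nonempty path from $s$ to some $v$ and on to some $w$ with an extra edge $w\to v$ closing a lossy cycle through $v$ and $w$ (possibly $v=w$, a self-loop). It determines a unique feasible $f$ vanishing off its edges; the augmented path is a solution of the GSP instance if this $f$ is optimal. The graph $G$. Vertices: $(\mathcal M_K)$ (the source); $(\mathcal M_i,j)$ for $0\le i\le K-1$, $1\le j\le\overline T$; and $(\mathcal M_i,L)$ for $0\le i\le K-1$, where $L$ is a formal symbol. Edges, with multiplier $\mu$ and cost $c$: (1) $(\mathcal M_K)\to(\mathcal M_i,j)$ for all $i,j$: $\mu=\frac{1-\alpha_{i,K}}{1-\alpha_{i,K}^{j+1}}$, cost $\frac{1-\alpha_{i,K}}{1-\alpha_{i,K}^{j+1}}\,c_K$; (2) $(\mathcal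 M_i,j)\to(\mathcal M_k,\ell)$ for all $i>k$, $j\ge\ell$: $\mu=\gamma(\alpha_{k,i},\ell,j)$, cost $\gamma(\alpha_{k,i},\ell,j)\,c_i$; (3) $(\mathcal M_i,j)\to(\mathcal M_i,L)$ for all $i,j$: $\mu=1$, cost $j\,c_i$; (4) self-loops $(\mathcal M_i,L)\to(\mathcal M_i,L)$ for all $i$: $\mu=\tfrac12$, cost $0$. Every augmented path in $G$ starting at the source has the form $(\mathcal M_K)\to(\mathcal M_{p_1},t_1)\to\dots\to(\mathcal M_{p_r},t_r)\to(\mathcal M_{p_r},L)\circlearrowleft$ with $r\ge1$; its corresponding hierarchy is $\sigma=(p_r,p_{r-1},\dots,p_1,K)$, $T=(t_r,t_{r-1},\dots,t_1)$. *)

theory Defs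
  imports "HOL-Probability.Probability" "Graph_Theory.Graph_Theory"
begin

section \<open>The Generalized Shortest Path problem\<close>

text \<open>A digraph without parallel edges is a \<open>pair_pre_digraph\<close>; self-loops are allowed.
  Multipliers, costs and flows are functions on pairs, of which only the values on
  \<open>parcs G\<close> matter.\<close>

definition gsp_instance ::
    "'v pair_pre_digraph \<Rightarrow> ('v \<times> 'v \<Rightarrow> real) \<Rightarrow> 'v \<Rightarrow> bool" where
  "gsp_instance G \<mu> s \<longleftrightarrow>
     pair_fin_digraph G \<and> (\<forall>e\<in>parcs G. 0 < \<mu> e) \<and> s \<in> pverts G"

definition gsp_feasible ::
    "'v pair_pre_digraph \<Rightarrow> ('v \<times> 'v \<Rightarrow> real) \<Rightarrow> 'v \<Rightarrow> ('v \<times> 'v \<Rightarrow> real) \<Rightarrow> bool" where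
  "gsp_feasible G \<mu> s f \<longleftrightarrow>
     (\<forall>e\<in>parcs G. 0 \<le> f e) \<and>
     (\<forall>v\<in>pverts G. (\<Sum>e\<in>out_arcs G v. f e) - (\<Sum>e\<in>in_arcs G v. \<mu> e * f e)
        = (if v = s then 1 else 0))"

definition gsp_cost ::
    "'v pair_pre_digraph \<Rightarrow> ('v \<times> 'v \<Rightarrow> real) \<Rightarrow> ('v \<times> 'v \<Rightarrow> real) \<Rightarrow> real" where
  "gsp_cost G c f = (\<Sum>e\<in>parcs G. f e * c e)"

definition gsp_optimal ::
    "'v pair_pre_digraph \<Rightarrow> ('v \<times> 'v \<Rightarrow> real) \<Rightarrow> ('v \<times> 'v \<Rightarrow> real) \<Rightarrow> 'v \<Rightarrow>
     ('v \<times> 'v \<Rightarrow> real) \<Rightarrow> bool" where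
  "gsp_optimal G \<mu> c s f \<longleftrightarrow>
     gsp_feasible G \<mu> s f \<and>
     (\<forall>g. gsp_feasible G \<mu> s g \<longrightarrow> gsp_cost G c f \<le> gsp_cost G c g)"

definition lossy_cycle ::
    "'v pair_pre_digraph \<Rightarrow> ('v \<times> 'v \<Rightarrow> real) \<Rightarrow> ('v \<times> 'v) list \<Rightarrow> bool" where
  "lossy_cycle G \<mu> C \<longleftrightarrow> pre_digraph.cycle G C \<and> (\<Prod>e\<leftarrow>C. \<mu> e) < 1"

text \<open>An augmented path is given by three pieces: the edge list \<open>p\<close> of the path from \<open>s\<close> to
  \<open>v\<close>, the edge list \<open>q\<close> of its continuation from \<open>v\<close> to \<open>w\<close> (empty if \<open>v = w\<close>), and the
  closing edge \<open>e = (w, v)\<close>, so that \<open>w = fst e\<close> and \<open>v = snd e\<close>. The lossy cycle is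
  \<open>q @ [e]\<close>.\<close>

definition augmented_path ::
    "'v pair_pre_digraph \<Rightarrow> ('v \<times> 'v \<Rightarrow> real) \<Rightarrow> 'v \<Rightarrow>
     ('v \<times> 'v) list \<Rightarrow> ('v \<times> 'v) list \<Rightarrow> 'v \<times> 'v \<Rightarrow> bool" where
  "augmented_path G \<mu> s p q e \<longleftrightarrow>
     p @ q \<noteq> [] \<and>
     pre_digraph.apath G s (p @ q) (fst e) \<and>
     pre_digraph.awalk G s p (snd e) \<and>
     pre_digraph.awalk G (snd e) q (fst e) \<and>
     lossy_cycle G \<mu> (q @ [e])"

text \<open>The values of \<open>f\<close> on pairs that are not edges of \<open>G\<close> are fixed to be \<open>0\<close> as well, which
  makes the description unique.\<close>

definition augmented_path_flow ::
    "'v pair_pre_digraph \<Rightarrow> ('v \<times> 'v \<Rightarrow> real) \<Rightarrow> 'v \<Rightarrow>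
     ('v \<times> 'v) list \<Rightarrow> ('v \<times> 'v) list \<Rightarrow> 'v \<times> 'v \<Rightarrow> ('v \<times> 'v \<Rightarrow> real)" where
  "augmented_path_flow G \<mu> s p q e =
     (THE f. gsp_feasible G \<mu> s f \<and> (\<forall>a. a \<notin> set (p @ q @ [e]) \<longrightarrow> f a = 0))"

definition gsp_solution ::
    "'v pair_pre_digraph \<Rightarrow> ('v \<times> 'v \<Rightarrow> real) \<Rightarrow> ('v \<times> 'v \<Rightarrow> real) \<Rightarrow> 'v \<Rightarrow>
     ('v \<times> 'v) list \<Rightarrow> ('v \<times> 'v) list \<Rightarrow> 'v \<times> 'v \<Rightarrow> bool" where
  "gsp_solution G \<mu> c s p q e \<longleftrightarrow>
     augmented_path G \<mu> s p q e \<and> gsp_optimal G \<mu> c s (augmented_path_flow G \<mu> s p q e)"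


section \<open>The HSD problem\<close>

text \<open>Distribution of \<open>1 + G\<close>, where \<open>G\<close> is the number of successes before the first failure
  among \<open>a\<close> independent trials with success probability \<open>\<alpha>\<close>.\<close>

definition accept_pmf :: "real \<Rightarrow> nat \<Rightarrow> nat pmf" where
  "accept_pmf \<alpha> a =
     map_pmf (\<lambda>xs. 1 + length (takeWhile (\<lambda>success. success) xs))
       (replicate_pmf a (bernoulli_pmf \<alpha>))"

text \<open>The i.i.d. sequence is realized as the coordinates of the countable product space,
  with \<open>N i\<close> standing for the \<open>(i + 1)\<close>-st variable.\<close>

definition gam :: "real \<Rightarrow> nat \<Rightarrow> nat \<Rightarrow> real" where
  "gam \<alpha> a b =
     prob_space.expectation (Pi\<^sub>M (UNIV :: nat set) (\<lambda>_. measure_pmf (accept_pmf \<alpha> a)))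
       (\<lambda>N. real (LEAST r. 1 \<le> r \<and> b \<le> (\<Sum>i<r. N i)))"

definition target_rate :: "real \<Rightarrow> nat \<Rightarrow> real" where
  "target_rate \<alpha> t = (if \<alpha> = 1 then 1 / (real t + 1) else (1 - \<alpha>) / (1 - \<alpha> ^ (t + 1)))"

definition hierarchy :: "nat \<Rightarrow> nat \<Rightarrow> nat list \<Rightarrow> nat list \<Rightarrow> bool" where
  "hierarchy K Tmax \<sigma> T \<longleftrightarrow>
     sorted_wrt (<) \<sigma> \<and> set \<sigma> \<subseteq> {0..K} \<and>
     1 \<le> length T \<and> length \<sigma> = length T + 1 \<and> last \<sigma> = K \<and>
     set T \<subseteq> {1..Tmax}"

definition stage_rate ::
    "(nat \<Rightarrow> nat \<Rightarrow> real) \<Rightarrow> nat list \<Rightarrow> nat list \<Rightarrow> nat \<Rightarrow> real" where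
  "stage_rate \<alpha> \<sigma> T j =
     (if j = 0 then real (T ! 0)
      else if j = length T then target_rate (\<alpha> (\<sigma> ! (j - 1)) (\<sigma> ! j)) (T ! (j - 1))
      else gam (\<alpha> (\<sigma> ! (j - 1)) (\<sigma> ! j)) (T ! (j - 1)) (T ! j))"

definition latency ::
    "(nat \<Rightarrow> real) \<Rightarrow> (nat \<Rightarrow> nat \<Rightarrow> real) \<Rightarrow> nat list \<Rightarrow> nat list \<Rightarrow> real" where
  "latency c \<alpha> \<sigma> T =
     (\<Sum>i = 0..length T. c (\<sigma> ! i) * (\<Prod>j = i..length T. stage_rate \<alpha> \<sigma> T j))"

definition hsd_optimal ::
    "nat \<Rightarrow> nat \<Rightarrow> (nat \<Rightarrow> real) \<Rightarrow> (nat \<Rightarrow> nat \<Rightarrow> real) \<Rightarrow> nat list \<Rightarrow> nat list \<Rightarrow> bool" where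
  "hsd_optimal K Tmax c \<alpha> \<sigma> T \<longleftrightarrow>
     hierarchy K Tmax \<sigma> T \<and>
     (\<forall>\<sigma>' T'. hierarchy K Tmax \<sigma>' T' \<longrightarrow> latency c \<alpha> \<sigma> T \<le> latency c \<alpha> \<sigma>' T')"


section \<open>The graph of an HSD instance\<close>

datatype vertex = Target | Draft nat nat | Final nat
  \<comment> \<open>\<open>Target\<close> is the source (M_K), \<open>Draft i j\<close> is (M_i, j), and \<open>Final i\<close> is (M_i, L).\<close>

definition hsd_graph :: "nat \<Rightarrow> nat \<Rightarrow> vertex pair_pre_digraph" where
  "hsd_graph K Tmax =
     \<lparr> pverts = {Target} \<union> {Draft i j | i j. i < K \<and> j \<in> {1..Tmax}} \<union> {Final i | i. i < K},
       parcs =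
         {(Target, Draft i j) | i j. i < K \<and> j \<in> {1..Tmax}} \<union>
         {(Draft i j, Draft k l) | i j k l.
            i < K \<and> k < i \<and> j \<in> {1..Tmax} \<and> l \<in> {1..Tmax} \<and> l \<le> j} \<union>
         {(Draft i j, Final i) | i j. i < K \<and> j \<in> {1..Tmax}} \<union>
         {(Final i, Final i) | i. i < K} \<rparr>"

fun hsd_mult :: "nat \<Rightarrow> (nat \<Rightarrow> nat \<Rightarrow> real) \<Rightarrow> vertex \<times> vertex \<Rightarrow> real" where
  "hsd_mult K \<alpha> (Target, Draft i j) = target_rate (\<alpha> i K) j"
| "hsd_mult K \<alpha> (Draft i j, Draft k l) = gam (\<alpha> k i) l j"
| "hsd_mult K \<alpha> (Draft i j, Final k) = 1"
| "hsd_mult K \<alpha> (Final i, Final k) = 1 / 2"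
| "hsd_mult K \<alpha> _ = 0"  \<comment> \<open>not edges\<close>

fun hsd_cost ::
    "nat \<Rightarrow> (nat \<Rightarrow> real) \<Rightarrow> (nat \<Rightarrow> nat \<Rightarrow> real) \<Rightarrow> vertex \<times> vertex \<Rightarrow> real" where
  "hsd_cost K c \<alpha> (Target, Draft i j) = target_rate (\<alpha> i K) j * c K"
| "hsd_cost K c \<alpha> (Draft i j, Draft k l) = gam (\<alpha> k i) l j * c i"
| "hsd_cost K c \<alpha> (Draft i j, Final k) = real j * c i"
| "hsd_cost K c \<alpha> _ = 0"  \<comment> \<open>self-loops, and pairs that are not edges\<close>

text \<open>The hierarchy corresponding to an augmented path, read off from the vertices
  \<open>Target, Draft p1 t1, ..., Draft pr tr, Final pr\<close> of its underlying path \<open>p @ q\<close>.\<close>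

definition path_models ::
    "nat \<Rightarrow> nat \<Rightarrow> (vertex \<times> vertex) list \<Rightarrow> (vertex \<times> vertex) list \<Rightarrow> nat list" where
  "path_models K Tmax p q =
     rev [i. Draft i j \<leftarrow> pre_digraph.awalk_verts (hsd_graph K Tmax) Target (p @ q)] @ [K]"

definition path_params ::
    "nat \<Rightarrow> nat \<Rightarrow> (vertex \<times> vertex) list \<Rightarrow> (vertex \<times> vertex) list \<Rightarrow> nat list" where
  "path_params K Tmax p q =
     rev [j. Draft i j \<leftarrow> pre_digraph.awalk_verts (hsd_graph K Tmax) Target (p @ q)]"


section \<open>The instance is well-formed\<close>

text \<open>The stopping time in \<open>gam\<close> is integrable, so its Bochner integral is the genuine
  expectation, and all multipliers are positive.\<close>

lemma accept_pmf_ge_1: "N \<in> set_pmf (accept_pmf \<alpha> a) \<Longrightarrow> 1 \<le> N"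
  by (auto simp: accept_pmf_def)

lemma AE_accept_ge_1:
  "AE N in Pi\<^sub>M (UNIV :: nat set) (\<lambda>_. measure_pmf (accept_pmf \<alpha> a)).
     (\<forall>i. 1 \<le> N i)"
proof -
  interpret product_prob_space "\<lambda>_::nat. measure_pmf (accept_pmf \<alpha> a)" UNIV
    by unfold_locales
  show ?thesis
    unfolding AE_all_countable
  proof
    fix i :: nat
    show "AE N in Pi\<^sub>M (UNIV :: nat set) (\<lambda>_. measure_pmf (accept_pmf \<alpha> a)). 1 \<le> N i"
      by (rule AE_component) (auto simp: AE_measure_pmf_iff dest: accept_pmf_ge_1)
  qed
qed

lemma Least_bounds:
  fixes N :: "nat \<Rightarrow> nat"
  assumes "\<forall>i. 1 \<le> N i"
  shows "1 \<le> (LEAST r. 1 \<le> r \<and> b \<le> (\<Sum>i<r. N i))"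
    "(LEAST r. 1 \<le> r \<and> b \<le> (\<Sum>i<r. N i)) \<le> Suc b"
proof -
  let ?P = "\<lambda>r. 1 \<le> r \<and> b \<le> (\<Sum>i<r. N i)"
  have "(\<Sum>i<Suc b. 1) \<le> (\<Sum>i<Suc b. N i)"
    by (rule sum_mono) (use assms in blast)
  then have *: "?P (Suc b)" by simp
  show "1 \<le> (LEAST r. ?P r)" using LeastI[of ?P, OF *] by (rule conjunct1)
  show "(LEAST r. ?P r) \<le> Suc b" by (rule Least_le[of ?P, OF *])
qed

lemma gam_facts:
  shows integrable_gam: "integrable (Pi\<^sub>M (UNIV :: nat set) (\<lambda>_. measure_pmf (accept_pmf \<alpha> a)))
     (\<lambda>N. real (LEAST r. 1 \<le> r \<and> b \<le> (\<Sum>i<r. N i)))"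
  and gam_ge_1: "1 \<le> gam \<alpha> a b"
proof -
  let ?M = "Pi\<^sub>M (UNIV :: nat set) (\<lambda>_. measure_pmf (accept_pmf \<alpha> a))"
  let ?g = "\<lambda>N :: nat \<Rightarrow> nat. LEAST r. 1 \<le> r \<and> b \<le> (\<Sum>i<r. N i)"
  interpret P: product_prob_space "\<lambda>_::nat. measure_pmf (accept_pmf \<alpha> a)" UNIV
    by unfold_locales
  have comp: "(\<lambda>N. N i) \<in> measurable ?M (count_space UNIV)" for i
    using measurable_component_singleton[of i UNIV "\<lambda>_. measure_pmf (accept_pmf \<alpha> a)"]
    by simp
  have s: "(\<lambda>N. \<Sum>i<r. N i) \<in> measurable ?M (count_space UNIV)" for r
  proof (induction r)
    case 0 show ?case by simp
  next
    case (Suc r)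
    have "(\<lambda>N. x + N r) \<in> measurable ?M (count_space UNIV)" for x
      by (rule measurable_compose[OF comp]) simp
    from measurable_compose_countable[of "\<lambda>x N. x + N r", OF this Suc] show ?case
      by simp
  qed
  have m: "?g \<in> measurable ?M (count_space UNIV)"
  proof (rule measurable_Least)
    fix r
    note [measurable] = s[of r]
    show "Measurable.pred ?M (\<lambda>N. 1 \<le> r \<and> b \<le> (\<Sum>i<r. N i))" by measurable
  qed
  have mr: "(\<lambda>N. real (?g N)) \<in> borel_measurable ?M"
    by (rule measurable_compose[OF m]) simp
  have u: "AE N in ?M. norm (real (?g N)) \<le> real (Suc b)"
    using AE_accept_ge_1[of \<alpha> a] by (rule eventually_mono)
      (simp only: real_norm_def abs_of_nat of_nat_le_iff, erule Least_bounds(2))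
  have l: "AE N in ?M. 1 \<le> real (?g N)"
    using AE_accept_ge_1[of \<alpha> a] by (rule eventually_mono)
      (subst real_of_nat_ge_one_iff, erule Least_bounds(1))
  show int: "integrable ?M (\<lambda>N. real (?g N))"
    by (rule P.integrable_const_bound[OF u mr])
  have "(\<integral>N. 1 \<partial>?M) \<le> (\<integral>N. real (?g N) \<partial>?M)"
    by (rule integral_mono_AE[OF _ int l]) simp
  then show "1 \<le> gam \<alpha> a b" by (simp only: gam_def) (simp add: P.P.prob_space)
qed

lemma target_rate_pos:
  assumes "0 \<le> \<alpha>" "\<alpha> \<le> 1"
  shows "0 < target_rate \<alpha> t"
proof (cases "\<alpha> = 1")
  case False
  with assms have "\<alpha> ^ Suc t < 1"
    by (cases "\<alpha> = 0") (auto intro!: power_Suc_less_one simp del: power_Suc)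
  with assms False show ?thesis by (simp add: target_rate_def)
qed (simp add: target_rate_def)

lemma gsp_instance_hsd_graph:
  assumes "\<And>i j. i \<le> K \<Longrightarrow> j \<le> K \<Longrightarrow> 0 \<le> \<alpha> i j \<and> \<alpha> i j \<le> 1"
  shows "gsp_instance (hsd_graph K Tmax) (hsd_mult K \<alpha>) Target"
proof -
  let ?G = "hsd_graph K Tmax"
  let ?V = "pverts ?G"
  have "?V \<subseteq> {Target} \<union> (\<lambda>(i, j). Draft i j) ` ({..K} \<times> {..Tmax}) \<union> Final ` {..K}"
    by (auto simp: hsd_graph_def)
  then have fin: "finite ?V" by (rule finite_subset) auto
  have sub: "parcs ?G \<subseteq> ?V \<times> ?V"
    by (auto simp: hsd_graph_def)
  have fin': "finite (parcs ?G)"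
    by (rule finite_subset[OF sub]) (use fin in simp)
  have g: "0 < gam x a b" for x a b by (rule less_le_trans[OF zero_less_one gam_ge_1])
  have pos: "\<forall>a\<in>parcs ?G. 0 < hsd_mult K \<alpha> a"
    using assms by (auto simp: hsd_graph_def g intro!: target_rate_pos)
  have "pair_fin_digraph ?G"
    by unfold_locales (use sub fin fin' in auto)
  then show ?thesis
    using pos by (simp add: gsp_instance_def) (simp add: hsd_graph_def)
qed

end

(* The flow of an augmented path costs exactly the latency of its hierarchy. The graph contains only
   the hierarchies whose parameters are monotone, but this loses nothing: if a > b, then drafting a
   tokens where b suffice brings no gain, because sum N_i >= b iff sum min(N_i, b + 1) >= b, so that
   gamma(alpha, a, b) = gamma(alpha, b, b), and lowering a to b can only decrease the preceding
   factor. Conversely, the least latency over all hierarchies that continue from a vertex is a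
   potential on the graph, so by weak linear programming duality no flow beats the best hierarchy. *)
theory Submission
  imports Defs
begin

section \<open>The expected number of rounds\<close>

text \<open>Almost surely every \<open>N i\<close> is at least 1, so both stopping times are
  attained; the round at which the sum reaches \<open>b'\<close> is then a candidate for
  \<open>b\<close>.\<close>

lemma gam_mono:
  assumes "b \<le> b'"
  shows "gam \<alpha> a b \<le> gam \<alpha> a b'"
  unfolding gam_def
proof (rule integral_mono_AE[OF integrable_gam integrable_gam])
  show "AE N in Pi\<^sub>M UNIV (\<lambda>_. measure_pmf (accept_pmf \<alpha> a)).
      real (LEAST r. 1 \<le> r \<and> b \<le> (\<Sum>i<r. N i)) \<le> real (LEAST r. 1 \<le> r \<and> b' \<le> (\<Sum>i<r. N i))"
    using AE_accept_ge_1
  proof (rule eventually_mono)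
    fix N :: "nat \<Rightarrow> nat" assume N: "\<forall>i. 1 \<le> N i"
    let ?P = "\<lambda>r. 1 \<le> r \<and> b' \<le> (\<Sum>i<r. N i)"
    \<comment> \<open>The successor keeps the number of rounds positive even for
      \<open>b' = 0\<close>.\<close>
    have "(\<Sum>i<Suc b'. 1) \<le> (\<Sum>i<Suc b'. N i)"
      by (rule sum_mono) (use N in blast)
    then have "?P (Suc b')" by simp
    from LeastI[of ?P, OF this]
    show "real (LEAST r. 1 \<le> r \<and> b \<le> (\<Sum>i<r. N i)) \<le> real (Least ?P)"
      using assms by (intro of_nat_mono Least_le) auto
  qed
qed

section \<open>Coupling rounds with different numbers of trials\<close>

lemma map_take_replicate_pmf:
  assumes "a \<le> a'"
  shows "map_pmf (take a) (replicate_pmf a' p) = replicate_pmf a p"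
proof -
  obtain d where d: "a' = a + d" using assms le_Suc_ex by blast
  have "map_pmf (take a) (replicate_pmf (a + d) p) =
      replicate_pmf a p \<bind> (\<lambda>xs. replicate_pmf d p \<bind> (\<lambda>ys. return_pmf (take a (xs @ ys))))"
    by (simp add: replicate_pmf_distrib map_bind_pmf)
  also have "\<dots> = replicate_pmf a p \<bind> (\<lambda>xs. replicate_pmf d p \<bind> (\<lambda>ys. return_pmf xs))"
    by (intro bind_pmf_cong refl) (simp add: set_replicate_pmf)
  finally show ?thesis by (simp add: d bind_return_pmf')
qed

lemma takeWhile_take: "takeWhile P (take n xs) = take n (takeWhile P xs)"
  by (induction xs arbitrary: n) (auto simp: take_Cons split: nat.split)

text \<open>The first \<open>a\<close> of \<open>a'\<close> trials are themselves \<open>a\<close>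
  independent trials, and passing to this prefix cuts the initial run of successes off at
  \<open>a\<close>.\<close>

lemma accept_pmf_min:
  assumes "a \<le> a'"
  shows "accept_pmf \<alpha> a = map_pmf (\<lambda>n. min n (a + 1)) (accept_pmf \<alpha> a')"
  unfolding accept_pmf_def map_take_replicate_pmf[OF assms, symmetric] pmf.map_comp
  by (intro map_pmf_cong refl) (simp add: takeWhile_take min_def)

text \<open>Probability measures on the product are determined by finite cylinders, and the preimage
  of a cylinder is the cylinder over the preimages of its sides. The restriction to \<open>I\<close>
  keeps the image functions extensional.\<close>

lemma PiM_map_pmf:
  fixes p :: "'a pmf" and f :: "'a \<Rightarrow> 'b"
  shows "Pi\<^sub>M I (\<lambda>_. measure_pmf (map_pmf f p)) =
    distr (Pi\<^sub>M I (\<lambda>_. measure_pmf p)) (Pi\<^sub>M I (\<lambda>_. measure_pmf (map_pmf f p))) (\<lambda>x. \<lambda>i\<in>I. f (x i))"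
    (is "?Q = distr ?P ?Q ?t")
proof (rule measure_eqI_PiM_infinite[OF refl])
  interpret Q: prob_space ?Q
    by (intro prob_space_PiM measure_pmf.prob_space_axioms)
  show "finite_measure ?Q" by unfold_locales
  have [measurable]: "?t \<in> measurable ?P ?Q"
    by (rule measurable_restrict) (rule measurable_compose[OF measurable_component_singleton], auto)
  fix J A assume J: "finite J" "J \<subseteq> I"
  have "?Q (prod_emb I (\<lambda>_. measure_pmf (map_pmf f p)) J (Pi\<^sub>E J A)) =
      (\<Prod>i\<in>J. emeasure (measure_pmf p) (f -` A i))"
    using J by (subst emeasure_PiM_emb) (auto intro: measure_pmf.prob_space_axioms)
  also have "\<dots> = ?P (prod_emb I (\<lambda>_. measure_pmf p) J (\<Pi>\<^sub>E i\<in>J. f -` A i))"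
    using J by (subst emeasure_PiM_emb) (auto intro: measure_pmf.prob_space_axioms)
  also have "prod_emb I (\<lambda>_. measure_pmf p) J (\<Pi>\<^sub>E i\<in>J. f -` A i) =
      ?t -` prod_emb I (\<lambda>_. measure_pmf (map_pmf f p)) J (Pi\<^sub>E J A) \<inter> space ?P"
  proof (rule set_eqI)
    fix x
    \<comment> \<open>The conditional unfolds the restriction; as \<open>J\<close> lies in
      \<open>I\<close>, only its first branch occurs.\<close>
    have "(\<forall>i\<in>J. (if i \<in> I then f (x i) else undefined) \<in> A i) \<longleftrightarrow> (\<forall>i\<in>J. f (x i) \<in> A i)"
      using J by (intro ball_cong) auto
    then show "x \<in> prod_emb I (\<lambda>_. measure_pmf p) J (\<Pi>\<^sub>E i\<in>J. f -` A i) \<longleftrightarrow>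
        x \<in> ?t -` prod_emb I (\<lambda>_. measure_pmf (map_pmf f p)) J (Pi\<^sub>E J A) \<inter> space ?P"
      using J by (auto simp: prod_emb_def space_PiM PiE_iff Pi_iff)
  qed
  also have "?P \<dots> = distr ?P ?Q ?t (prod_emb I (\<lambda>_. measure_pmf (map_pmf f p)) J (Pi\<^sub>E J A))"
    using J by (intro emeasure_distr[symmetric] sets_PiM_I) auto
  finally show "?Q (prod_emb I (\<lambda>_. measure_pmf (map_pmf f p)) J (Pi\<^sub>E J A)) =
      distr ?P ?Q ?t (prod_emb I (\<lambda>_. measure_pmf (map_pmf f p)) J (Pi\<^sub>E J A))" .
qed simp

text \<open>A summand above \<open>b\<close> stays above \<open>b\<close> after capping and alone
  makes both sums reach \<open>b\<close>; without such a summand the cap changes nothing. The cap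
  \<open>b + 1\<close> is the one produced by \<open>b\<close> trials.\<close>

lemma le_sum_min_iff:
  fixes N :: "nat \<Rightarrow> nat"
  assumes "finite A"
  shows "b \<le> (\<Sum>i\<in>A. min (N i) (b + 1)) \<longleftrightarrow> b \<le> (\<Sum>i\<in>A. N i)"
proof (cases "\<exists>i\<in>A. b < N i")
  case True
  then obtain i where i: "i \<in> A" "b < N i" by blast
  have "min (N i) (b + 1) \<le> (\<Sum>i\<in>A. min (N i) (b + 1))" "N i \<le> (\<Sum>i\<in>A. N i)"
    using assms i member_le_sum[of i A "\<lambda>i. min (N i) (b + 1)"] member_le_sum[of i A N] by auto
  with i show ?thesis by linarith
next
  case False
  then have "(\<Sum>i\<in>A. min (N i) (b + 1)) = (\<Sum>i\<in>A. N i)"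
    by (intro sum.cong refl) (auto simp: not_less)
  then show ?thesis by simp
qed

text \<open>With \<open>b\<close> trials the variables are distributed as those with
  \<open>a\<close> trials capped at \<open>b + 1\<close>, and capping leaves the round at which the
  sum reaches \<open>b\<close> unchanged for every sample.\<close>

lemma gam_excess:
  assumes "b \<le> a"
  shows "gam \<alpha> a b = gam \<alpha> b b"
proof -
  let ?M = "\<lambda>a. Pi\<^sub>M (UNIV :: nat set) (\<lambda>_. measure_pmf (accept_pmf \<alpha> a))"
  let ?g = "\<lambda>N. real (LEAST r. 1 \<le> r \<and> b \<le> (\<Sum>i<r. N i :: nat))"
  let ?t = "\<lambda>N :: nat \<Rightarrow> nat. \<lambda>i. min (N i) (b + 1)"
  have distr: "?M b = distr (?M a) (?M b) ?t"
    using PiM_map_pmf[of UNIV "\<lambda>n. min n (b + 1)" "accept_pmf \<alpha> a"]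
    by (simp add: accept_pmf_min[OF assms] restrict_def)
  have "?t \<in> measurable (?M a) (?M b)"
    by (rule measurable_PiM_single') (auto intro!: measurable_compose[OF measurable_component_singleton])
  moreover have "?g \<in> borel_measurable (?M b)"
    by (rule borel_measurable_integrable[OF integrable_gam])
  ultimately have "integral\<^sup>L (distr (?M a) (?M b) ?t) ?g = (\<integral>N. ?g (?t N) \<partial>?M a)"
    by (rule integral_distr)
  also have "\<dots> = integral\<^sup>L (?M a) ?g"
    using le_sum_min_iff[OF finite_lessThan] by simp
  finally show ?thesis
    unfolding gam_def distr[symmetric] by simp
qed


section \<open>Path flows and duality\<close>

text \<open>Meant for functions of any sign, so that the difference of two feasible flows can be
  treated as a circulation.\<close>

definition net_outflow ::
    "'v pair_pre_digraph \<Rightarrow> ('v \<times> 'v \<Rightarrow> real) \<Rightarrow> ('v \<times> 'v \<Rightarrow> real) \<Rightarrow> 'v \<Rightarrow> real" where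
  "net_outflow G m f v = (\<Sum>a\<in>out_arcs G v. f a) - (\<Sum>a\<in>in_arcs G v. m a * f a)"

lemma gsp_feasible_iff_net_outflow:
  "gsp_feasible G m s f \<longleftrightarrow>
    (\<forall>a\<in>parcs G. 0 \<le> f a) \<and> (\<forall>v\<in>pverts G. net_outflow G m f v = of_bool (v = s))"
  by (simp add: gsp_feasible_def net_outflow_def of_bool_def)

text \<open>One unit of flow is sent along the path, and the self-loop at its endpoint \<open>w\<close> absorbs what
  arrives there: a loop flow \<open>x\<close> has net outflow \<open>(1 - m (w, w)) * x\<close> at \<open>w\<close>.\<close>

fun path_flow :: "('v \<times> 'v \<Rightarrow> real) \<Rightarrow> 'v \<Rightarrow> ('v \<times> 'v) list \<Rightarrow> 'v \<times> 'v \<Rightarrow> real" where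
  "path_flow m w [] a = (if a = (w, w) then 1 / (1 - m (w, w)) else 0)"
| "path_flow m w (e # es) a = (if a = e then 1 else 0) + m e * path_flow m w es a"

fun path_cost :: "('v \<times> 'v \<Rightarrow> real) \<Rightarrow> ('v \<times> 'v \<Rightarrow> real) \<Rightarrow> ('v \<times> 'v) list \<Rightarrow> real" where
  "path_cost m c [] = 0"
| "path_cost m c (e # es) = c e + m e * path_cost m c es"

lemma path_flow_eq_0: "a \<notin> insert (w, w) (set es) \<Longrightarrow> path_flow m w es a = 0"
  by (induction es) auto

context pair_fin_digraph
begin

lemma net_outflow_add:
  "net_outflow G m (\<lambda>a. f a + g a) v = net_outflow G m f v + net_outflow G m g v"
  by (simp add: net_outflow_def sum.distrib algebra_simps)

lemma net_outflow_diff: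
  "net_outflow G m (\<lambda>a. f a - g a) v = net_outflow G m f v - net_outflow G m g v"
  by (simp add: net_outflow_def sum_subtractf algebra_simps)

lemma net_outflow_scale:
  "net_outflow G m (\<lambda>a. r * f a) v = r * net_outflow G m f v"
  by (simp add: net_outflow_def sum_distrib_left algebra_simps)

lemma net_outflow_single:
  assumes "e \<in> parcs G"
  shows "net_outflow G m (\<lambda>a. if a = e then x else 0) v =
    (if v = fst e then x else 0) - (if v = snd e then m e * x else 0)"
proof -
  have "(\<Sum>a\<in>out_arcs G v. if a = e then x else 0) = (if v = fst e then x else 0)"
    using assms pair_finite_arcs by (auto simp: out_arcs_def sum.delta)
  moreover have "(\<Sum>a\<in>in_arcs G v. m a * (if a = e then x else 0)) =
      (\<Sum>a\<in>in_arcs G v. if a = e then m e * x else 0)"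
    by (intro sum.cong) auto
  moreover have "\<dots> = (if v = snd e then m e * x else 0)"
    using assms pair_finite_arcs by (auto simp: in_arcs_def sum.delta)
  ultimately show ?thesis by (simp add: net_outflow_def)
qed

text \<open>Induction along the walk: one unit on \<open>e\<close> leaves \<open>u\<close> and
  delivers \<open>m e\<close> units at \<open>snd e\<close>, exactly the supply of the tail flow
  scaled by \<open>m e\<close>.\<close>

lemma net_outflow_path_flow:
  assumes "awalk u es w" "(w, w) \<in> parcs G" "m (w, w) \<noteq> 1"
  shows "net_outflow G m (path_flow m w es) v = of_bool (v = u)"
  using assms(1)
proof (induction es arbitrary: u)
  case Nil
  then have u: "u = w" by (simp add: awalk_Nil_iff)
  have "path_flow m w [] = (\<lambda>a. if a = (w, w) then 1 / (1 - m (w, w)) else 0)" by auto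
  then show ?case
    using assms(2,3) u by (simp add: net_outflow_single field_simps)
next
  case (Cons e es)
  then have e: "e \<in> parcs G" "u = fst e" and "awalk (snd e) es w"
    by (auto simp: awalk_Cons_iff)
  from Cons.IH[OF this(3)]
  have IH: "net_outflow G m (path_flow m w es) v = of_bool (v = snd e)" .
  have "path_flow m w (e # es) = (\<lambda>a. (if a = e then 1 else 0) + m e * path_flow m w es a)"
    by auto
  then show ?case
    using e by (simp add: net_outflow_add net_outflow_scale IH net_outflow_single)
qed

lemma path_flow_nonneg:
  assumes "set es \<subseteq> parcs G" "\<And>a. a \<in> parcs G \<Longrightarrow> 0 \<le> m a" "m (w, w) < 1"
  shows "0 \<le> path_flow m w es a"
  using assms(1) by (induction es) (use assms(2,3) in auto)

lemma gsp_feasible_path_flow: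
  assumes "awalk u es w" "(w, w) \<in> parcs G" "m (w, w) < 1" "\<And>a. a \<in> parcs G \<Longrightarrow> 0 \<le> m a"
  shows "gsp_feasible G m u (path_flow m w es)"
  using assms net_outflow_path_flow[OF assms(1,2)]
  by (auto simp: gsp_feasible_iff_net_outflow awalk_def intro!: path_flow_nonneg)

lemma gsp_cost_path_flow:
  assumes "set es \<subseteq> parcs G" "c (w, w) = 0"
  shows "gsp_cost G c (path_flow m w es) = path_cost m c es"
  using assms(1)
proof (induction es)
  case Nil
  have "(\<Sum>a\<in>parcs G. path_flow m w [] a * c a) = (\<Sum>a\<in>parcs G. 0)"
    by (intro sum.cong) (use assms(2) in auto)
  then show ?case by (simp add: gsp_cost_def)
next
  case (Cons e es)
  have "gsp_cost G c (path_flow m w (e # es)) =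
      (\<Sum>a\<in>parcs G. (if a = e then c a else 0) + m e * (path_flow m w es a * c a))"
    unfolding gsp_cost_def by (intro sum.cong) (auto simp: algebra_simps)
  also have "\<dots> = c e + m e * gsp_cost G c (path_flow m w es)"
    using Cons.prems pair_finite_arcs by (simp add: sum.distrib sum_distrib_left gsp_cost_def)
  finally show ?case using Cons by (simp del: path_flow.simps)
qed

text \<open>On a simple path the first arc is the only arc of the support that touches the start, so
  conservation there forces its value to be 0, and it can be peeled off. What remains at the end is
  the loop, where conservation reads \<open>(1 - m (w, w)) * f (w, w) = 0\<close>.\<close>

lemma circulation_on_path_eq_0:
  assumes "apath u es w" "(w, w) \<in> parcs G" "m (w, w) \<noteq> 1"
    and "\<And>v. v \<in> pverts G \<Longrightarrow> net_outflow G m f v = 0"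
    and "\<And>a. a \<notin> insert (w, w) (set es) \<Longrightarrow> f a = 0"
  shows "f = (\<lambda>_. 0)"
  using assms(1,5)
proof (induction es arbitrary: u)
  case Nil
  have "w \<in> pverts G" using assms(2) arc_fst_in_verts by force
  moreover have "f = (\<lambda>a. if a = (w, w) then f (w, w) else 0)"
    using Nil.prems by auto
  ultimately have "f (w, w) - m (w, w) * f (w, w) = 0"
    using assms(4)[of w] net_outflow_single[OF assms(2), of m "f (w, w)" w] by simp
  then have "(1 - m (w, w)) * f (w, w) = 0" by (simp add: algebra_simps)
  then have "f (w, w) = 0" using assms(3) by simp
  with Nil.prems(2) have "f a = 0" for a by (cases "a = (w, w)") auto
  then show ?case by auto
next
  case (Cons e es)
  then have e: "e \<in> parcs G" "fst e = u" and path: "apath (snd e) es w"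
    and fresh: "u \<notin> set (pawalk_verts (snd e) es)"
    by (auto simp: apath_Cons_iff)
  have walk: "awalk (snd e) es w" using path by (rule awalkI_apath)
  have "w = last (pawalk_verts (snd e) es)"
    using walk unfolding awalk_def by (metis awlast_if_cas)
  then have w: "w \<in> set (pawalk_verts (snd e) es)"
    by (simp add: awalk_verts_non_Nil)
  \<comment> \<open>The loop and the arcs of the tail have both ends on the tail path, which avoids
    \<open>u\<close>; only \<open>e\<close> can carry flow out of \<open>u\<close>.\<close>
  have verts: "fst a \<in> set (pawalk_verts (snd e) es)" "snd a \<in> set (pawalk_verts (snd e) es)"
    if "a \<in> insert (w, w) (set es)" for a
    using that w awalk_verts_arc1[of a es "snd e"] awalk_verts_arc2[OF walk, of a] by auto
  have out: "f a = (if a = e then f e else 0)" if "a \<in> out_arcs G u" for a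
    using that verts[of a] fresh Cons.prems(2)[of a] by (auto simp: out_arcs_def)
  \<comment> \<open>This excludes that \<open>e\<close> itself re-enters \<open>u\<close>, so no
    flow enters \<open>u\<close>.\<close>
  have "snd e \<noteq> u" using fresh hd_in_awalk_verts(1)[OF walk] by auto
  then have "f a = 0" if "a \<in> in_arcs G u" for a
    using that verts[of a] fresh Cons.prems(2)[of a] by (auto simp: in_arcs_def)
  then have "net_outflow G m f u = (\<Sum>a\<in>out_arcs G u. if a = e then f e else 0)"
    unfolding net_outflow_def using out by simp
  also have "\<dots> = f e"
    using e pair_finite_arcs by (auto simp: out_arcs_def sum.delta)
  finally have "f e = 0"
    using assms(4)[of u] e arc_fst_in_verts by metis
  with Cons.prems(2) have "f a = 0" if "a \<notin> insert (w, w) (set es)" for a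
    using that by (cases "a = e") auto
  with Cons.IH[OF path] show ?case by blast
qed

text \<open>The explicit path flow is one candidate; its difference from any other is a circulation
  supported on the path and the loop, hence zero.\<close>

lemma augmented_path_flow_loop:
  assumes "apath s p w" "(w, w) \<in> parcs G" "m (w, w) < 1" "\<And>a. a \<in> parcs G \<Longrightarrow> 0 \<le> m a"
  shows "augmented_path_flow G m s p [] (w, w) = path_flow m w p"
  unfolding augmented_path_flow_def
proof (rule the_equality)
  have walk: "awalk s p w" using assms(1) by (rule awalkI_apath)
  show *: "gsp_feasible G m s (path_flow m w p) \<and>
      (\<forall>a. a \<notin> set (p @ [] @ [(w, w)]) \<longrightarrow> path_flow m w p a = 0)"
    using gsp_feasible_path_flow[of s p w m] walk assms(2-4) by (auto simp: path_flow_eq_0)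
  fix f assume f: "gsp_feasible G m s f \<and> (\<forall>a. a \<notin> set (p @ [] @ [(w, w)]) \<longrightarrow> f a = 0)"
  have "(\<lambda>a. f a - path_flow m w p a) = (\<lambda>_. 0)"
  proof (rule circulation_on_path_eq_0[OF assms(1,2)])
    show "m (w, w) \<noteq> 1" using assms(3) by simp
    show "net_outflow G m (\<lambda>a. f a - path_flow m w p a) v = 0" if "v \<in> pverts G" for v
      using that f * by (auto simp: gsp_feasible_iff_net_outflow net_outflow_diff)
    show "f a - path_flow m w p a = 0" if "a \<notin> insert (w, w) (set p)" for a
    proof -
      have "a \<notin> set (p @ [] @ [(w, w)])" using that by simp
      with f * have "f a = 0" "path_flow m w p a = 0" by blast+
      then show ?thesis by simp
    qed
  qed
  then show "f = path_flow m w p" by (simp add: fun_eq_iff)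
qed

text \<open>Weak duality: the arc inequalities make \<open>h\<close> feasible for the dual linear
  program. Weighting conservation at \<open>v\<close> by \<open>h v\<close> and summing turns
  \<open>h s\<close> into a sum over arcs that the cost dominates termwise.\<close>

lemma potential_le_gsp_cost:
  assumes "gsp_feasible G m s f" "s \<in> pverts G"
    and "\<And>u v. (u, v) \<in> parcs G \<Longrightarrow> h u \<le> c (u, v) + m (u, v) * h v"
  shows "h s \<le> gsp_cost G c f"
proof -
  have "h s = (\<Sum>v\<in>pverts G. h v * net_outflow G m f v)"
    using assms(1,2) pair_finite_verts by (simp add: gsp_feasible_iff_net_outflow)
  also have "\<dots> = (\<Sum>v\<in>pverts G. \<Sum>a\<in>out_arcs G v. h (fst a) * f a) -
      (\<Sum>v\<in>pverts G. \<Sum>a\<in>in_arcs G v. h (snd a) * (m a * f a))"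
    unfolding sum_subtractf[symmetric] net_outflow_def
    by (intro sum.cong refl)
       (auto simp: right_diff_distrib sum_distrib_left in_arcs_def out_arcs_def intro!: arg_cong2[of _ _ _ _ minus] sum.cong)
  \<comment> \<open>Grouping by tails and grouping by heads both partition the arcs.\<close>
  also have "\<dots> = (\<Sum>a\<in>parcs G. h (fst a) * f a) - (\<Sum>a\<in>parcs G. h (snd a) * (m a * f a))"
    unfolding in_arcs_def out_arcs_def with_proj_simps
    by (intro arg_cong2[of _ _ _ _ minus] sum.group pair_finite_arcs pair_finite_verts)
      (auto dest: in_arcsD1 in_arcsD2)
  also have "\<dots> = (\<Sum>a\<in>parcs G. f a * (h (fst a) - m a * h (snd a)))"
    unfolding sum_subtractf[symmetric] by (intro sum.cong) (auto simp: algebra_simps)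
  also have "\<dots> \<le> (\<Sum>a\<in>parcs G. f a * c a)"
  proof (intro sum_mono mult_left_mono)
    fix a assume "a \<in> parcs G"
    then show "h (fst a) - m a * h (snd a) \<le> c a" "0 \<le> f a"
      using assms(3)[of "fst a" "snd a"] assms(1) by (auto simp: gsp_feasible_def)
  qed
  finally show ?thesis by (simp add: gsp_cost_def)
qed

end


section \<open>Hierarchies as chains of drafts\<close>

text \<open>A chain lists the draft vertices \<open>(M_p1, t1), ..., (M_pr, tr)\<close> in path order, so it is the
  hierarchy read backwards from the target. Its parameters need not decrease along the list,
  i.e. it need not be a path of the graph.\<close>

definition chain :: "nat \<Rightarrow> nat \<Rightarrow> (nat \<times> nat) list \<Rightarrow> bool" where
  "chain K Tmax ds \<longleftrightarrow> sorted_wrt (\<lambda>x y. fst y < fst x) ds \<and> set ds \<subseteq> {..<K} \<times> {1..Tmax}"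

text \<open>Horner form of the latency of the stages up to the given draft, in the order in which a
  graph path meets them.\<close>

fun draft_latency ::
    "(nat \<Rightarrow> real) \<Rightarrow> (nat \<Rightarrow> nat \<Rightarrow> real) \<Rightarrow> nat \<times> nat \<Rightarrow> (nat \<times> nat) list \<Rightarrow> real" where
  "draft_latency c \<alpha> (i, j) [] = real j * c i"
| "draft_latency c \<alpha> (i, j) ((k, l) # ds) =
    gam (\<alpha> k i) l j * (c i + draft_latency c \<alpha> (k, l) ds)"

definition chain_latency ::
    "nat \<Rightarrow> (nat \<Rightarrow> real) \<Rightarrow> (nat \<Rightarrow> nat \<Rightarrow> real) \<Rightarrow> (nat \<times> nat) list \<Rightarrow> real" where
  "chain_latency K c \<alpha> ds =
    target_rate (\<alpha> (fst (hd ds)) K) (snd (hd ds)) * (c K + draft_latency c \<alpha> (hd ds) (tl ds))"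

text \<open>The factor \<open>R (Suc n)\<close> occurs in every product; pulling it out is one
  Horner step.\<close>

lemma sum_prod_interval_Suc:
  fixes C R :: "nat \<Rightarrow> 'a::comm_semiring_1"
  shows "(\<Sum>i=0..Suc n. C i * (\<Prod>j=i..Suc n. R j)) =
    R (Suc n) * (C (Suc n) + (\<Sum>i=0..n. C i * (\<Prod>j=i..n. R j)))"
proof -
  have "(\<Sum>i=0..n. C i * (\<Prod>j=i..Suc n. R j)) = (\<Sum>i=0..n. R (Suc n) * (C i * (\<Prod>j=i..n. R j)))"
    by (intro sum.cong refl) (simp add: algebra_simps)
  then show ?thesis
    by (simp add: sum_distrib_left algebra_simps)
qed

text \<open>Agrees with \<open>stage_rate\<close> below index \<open>length T\<close>; the separate
  target case is left to the final Horner step.\<close>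

definition draft_rate :: "(nat \<Rightarrow> nat \<Rightarrow> real) \<Rightarrow> nat list \<Rightarrow> nat list \<Rightarrow> nat \<Rightarrow> real" where
  "draft_rate \<alpha> \<sigma> T j =
    (if j = 0 then real (T ! 0) else gam (\<alpha> (\<sigma> ! (j - 1)) (\<sigma> ! j)) (T ! (j - 1)) (T ! j))"

text \<open>The free suffixes let the induction shorten the chain while \<open>\<sigma>\<close> and
  \<open>T\<close> stay fixed: the removed head moves into the suffix.\<close>

lemma draft_latency_eq_sum:
  assumes "\<sigma> = rev (map fst (d # ds)) @ \<sigma>'" "T = rev (map snd (d # ds)) @ T'"
  shows "(\<Sum>i=0..length ds. c (\<sigma> ! i) * (\<Prod>j=i..length ds. draft_rate \<alpha> \<sigma> T j)) =
    draft_latency c \<alpha> d ds"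
  using assms
proof (induction ds arbitrary: d \<sigma>' T')
  case Nil
  then show ?case by (cases d) (simp add: draft_rate_def)
next
  case (Cons d' ds)
  obtain i j k l where d: "d = (i, j)" "d' = (k, l)" by (cases d, cases d')
  have \<sigma>: "\<sigma> ! length ds = k" "\<sigma> ! Suc (length ds) = i" and
    T: "T ! length ds = l" "T ! Suc (length ds) = j"
    using Cons.prems d by (simp_all add: nth_append)
  have "(\<Sum>i=0..length ds. c (\<sigma> ! i) * (\<Prod>j=i..length ds. draft_rate \<alpha> \<sigma> T j)) =
      draft_latency c \<alpha> d' ds"
    using Cons.prems by (intro Cons.IH[of _ "fst d # \<sigma>'" "snd d # T'"]) simp_all
  then show ?case
    using \<sigma> T by (simp only: list.size add_Suc_right add_0_right sum_prod_interval_Suc)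
      (simp add: d draft_rate_def)
qed

lemma latency_eq_chain_latency:
  assumes "ds \<noteq> []"
  shows "latency c \<alpha> (rev (map fst ds) @ [K]) (rev (map snd ds)) = chain_latency K c \<alpha> ds"
proof -
  obtain d es where ds: "ds = d # es" using assms by (meson neq_Nil_conv)
  let ?\<sigma> = "rev (map fst ds) @ [K]" and ?T = "rev (map snd ds)"
  have "(\<Sum>i=0..length es. c (?\<sigma> ! i) * (\<Prod>j=i..length es. stage_rate \<alpha> ?\<sigma> ?T j)) =
      (\<Sum>i=0..length es. c (?\<sigma> ! i) * (\<Prod>j=i..length es. draft_rate \<alpha> ?\<sigma> ?T j))"
    by (intro sum.cong prod.cong arg_cong2[of _ _ _ _ times])
       (auto simp: stage_rate_def draft_rate_def ds)
  also have "\<dots> = draft_latency c \<alpha> d es"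
    by (rule draft_latency_eq_sum[where T' = "[]"]) (simp_all add: ds)
  finally have sum: "(\<Sum>i=0..length es. c (?\<sigma> ! i) * (\<Prod>j=i..length es. stage_rate \<alpha> ?\<sigma> ?T j)) =
      draft_latency c \<alpha> d es" .
  have "length ?T = Suc (length es)" by (simp add: ds)
  then have "latency c \<alpha> ?\<sigma> ?T =
      stage_rate \<alpha> ?\<sigma> ?T (Suc (length es)) * (c (?\<sigma> ! Suc (length es)) + draft_latency c \<alpha> d es)"
    unfolding latency_def by (simp only: sum_prod_interval_Suc sum)
  then show ?thesis
    by (simp add: ds chain_latency_def stage_rate_def nth_append)
qed

text \<open>Removing the final \<open>K\<close>, pairing the other models with their parameters and
  reversing gives the chain; strict sortedness of \<open>\<sigma>\<close> puts these models below
  \<open>K\<close>.\<close>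

lemma hierarchy_iff_chain:
  "hierarchy K Tmax \<sigma> T \<longleftrightarrow>
    (\<exists>ds. ds \<noteq> [] \<and> chain K Tmax ds \<and> \<sigma> = rev (map fst ds) @ [K] \<and> T = rev (map snd ds))"
proof
  assume h: "hierarchy K Tmax \<sigma> T"
  define ds where "ds = rev (zip (butlast \<sigma>) T)"
  have len: "length (butlast \<sigma>) = length T" and ne: "\<sigma> \<noteq> []"
    using h by (auto simp: hierarchy_def)
  have \<sigma>: "\<sigma> = butlast \<sigma> @ [K]"
    using h ne append_butlast_last_id[of \<sigma>] by (simp add: hierarchy_def)
  have eq: "rev (map fst ds) = butlast \<sigma>" "rev (map snd ds) = T"
    using len by (simp_all add: ds_def rev_map[symmetric])
  have "sorted_wrt (<) (butlast \<sigma> @ [K])"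
    using h \<sigma> by (simp add: hierarchy_def)
  then have sorted: "sorted_wrt (<) (butlast \<sigma>)" and less: "\<forall>i\<in>set (butlast \<sigma>). i < K"
    by (simp_all add: sorted_wrt_append)
  have "sorted_wrt (\<lambda>x y. fst y < fst x) ds"
    using sorted unfolding eq(1)[symmetric] by (simp add: sorted_wrt_rev sorted_wrt_map)
  moreover have "set ds \<subseteq> {..<K} \<times> {1..Tmax}"
  proof
    fix x assume "x \<in> set ds"
    then have "fst x \<in> set (rev (map fst ds))" "snd x \<in> set (rev (map snd ds))" by auto
    with less h show "x \<in> {..<K} \<times> {1..Tmax}"
      unfolding eq by (cases x) (auto simp: hierarchy_def)
  qed
  moreover have "ds \<noteq> []"
    using h eq(2) by (auto simp: hierarchy_def)
  ultimately show "\<exists>ds. ds \<noteq> [] \<and> chain K Tmax ds \<and> \<sigma> = rev (map fst ds) @ [K] \<and> T = rev (map snd ds)"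
    using eq \<sigma> by (auto simp: chain_def)
next
  assume "\<exists>ds. ds \<noteq> [] \<and> chain K Tmax ds \<and> \<sigma> = rev (map fst ds) @ [K] \<and> T = rev (map snd ds)"
  then obtain ds where "ds \<noteq> []" "chain K Tmax ds" "\<sigma> = rev (map fst ds) @ [K]" "T = rev (map snd ds)"
    by blast
  then show "hierarchy K Tmax \<sigma> T"
    by (cases ds) (auto simp: hierarchy_def chain_def sorted_wrt_append sorted_wrt_rev sorted_wrt_map
        Suc_le_eq intro: less_imp_le)
qed

lemma hsd_optimal_iff_chain:
  assumes "ds \<noteq> []" "chain K Tmax ds"
  shows "hsd_optimal K Tmax c \<alpha> (rev (map fst ds) @ [K]) (rev (map snd ds)) \<longleftrightarrow>
    (\<forall>es. es \<noteq> [] \<longrightarrow> chain K Tmax es \<longrightarrow> chain_latency K c \<alpha> ds \<le> chain_latency K c \<alpha> es)"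
proof -
  have "hierarchy K Tmax (rev (map fst ds) @ [K]) (rev (map snd ds))"
    unfolding hierarchy_iff_chain using assms by blast
  moreover have "(\<forall>\<sigma> T. hierarchy K Tmax \<sigma> T \<longrightarrow> x \<le> latency c \<alpha> \<sigma> T) \<longleftrightarrow>
      (\<forall>es. es \<noteq> [] \<longrightarrow> chain K Tmax es \<longrightarrow>
        x \<le> latency c \<alpha> (rev (map fst es) @ [K]) (rev (map snd es)))" for x
    unfolding hierarchy_iff_chain by blast
  ultimately show ?thesis
    using assms by (simp add: hsd_optimal_def latency_eq_chain_latency)
qed

section \<open>Lowering the parameters to running minima\<close>

fun clamp_params :: "nat \<Rightarrow> (nat \<times> nat) list \<Rightarrow> (nat \<times> nat) list" where
  "clamp_params b [] = []"
| "clamp_params b ((k, l) # ds) = (k, min l b) # clamp_params (min l b) ds"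

lemma map_fst_clamp_params: "map fst (clamp_params b ds) = map fst ds"
  by (induction b ds rule: clamp_params.induct) auto

lemma set_clamp_params:
  assumes "set ds \<subseteq> A \<times> {1..n}" "1 \<le> b"
  shows "set (clamp_params b ds) \<subseteq> A \<times> {1..n}"
  using assms by (induction b ds rule: clamp_params.induct) auto

lemma snd_clamp_params_le: "x \<in> set (clamp_params b ds) \<Longrightarrow> snd x \<le> b"
  by (induction b ds rule: clamp_params.induct) auto

lemma sorted_clamp_params: "sorted_wrt (\<lambda>x y. snd y \<le> snd x) (clamp_params b ds)"
  by (induction b ds rule: clamp_params.induct) (auto dest: snd_clamp_params_le)

lemma chain_clamp_params:
  assumes "chain K Tmax ds" "1 \<le> b"
  shows "chain K Tmax (clamp_params b ds)"
proof -
  have "sorted_wrt (\<lambda>x y. y < x) (map fst (clamp_params b ds))"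
    using assms(1) unfolding map_fst_clamp_params chain_def by (simp add: sorted_wrt_map)
  then show ?thesis
    using assms set_clamp_params[of ds "{..<K}" Tmax b] by (simp add: chain_def sorted_wrt_map)
qed

lemma draft_latency_nonneg:
  assumes "\<And>x. x \<in> set (d # ds) \<Longrightarrow> 0 \<le> c (fst x)"
  shows "0 \<le> draft_latency c \<alpha> d ds"
  using assms
proof (induction ds arbitrary: d)
  case Nil then show ?case by (cases d) auto
next
  case (Cons e es)
  have "0 \<le> draft_latency c \<alpha> e es" by (intro Cons.IH) (use Cons.prems in auto)
  moreover have "0 \<le> gam x a b" for x a b using gam_ge_1[of x a b] by linarith
  moreover have "0 \<le> c (fst d)" using Cons.prems by simp
  ultimately show ?case by (cases d, cases e) simp
qed

text \<open>Clamping passes \<open>min l b\<close> on to the tail, so the induction needs every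
  bound \<open>b\<close> up to the head parameter. Factors and brackets of the Horner form can then
  only decrease.\<close>

lemma draft_latency_clamp_params_le:
  assumes "\<And>x. x \<in> set (d # ds) \<Longrightarrow> 0 \<le> c (fst x)" and "b \<le> snd d"
  shows "draft_latency c \<alpha> (fst d, b) (clamp_params b ds) \<le> draft_latency c \<alpha> d ds"
  using assms
proof (induction ds arbitrary: d b)
  case Nil
  then show ?case by (cases d) (auto intro: mult_right_mono)
next
  case (Cons e es)
  obtain i j k l where d: "d = (i, j)" "e = (k, l)" by (cases d, cases e)
  have le: "draft_latency c \<alpha> (k, min l b) (clamp_params (min l b) es) \<le> draft_latency c \<alpha> e es"
    using Cons.IH[of e "min l b"] Cons.prems(1) d by auto
  \<comment> \<open>Clamping keeps the models, so their costs remain nonnegative.\<close>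
  have nonneg: "0 \<le> draft_latency c \<alpha> (k, min l b) (clamp_params (min l b) es)"
  proof (rule draft_latency_nonneg)
    fix x assume "x \<in> set ((k, min l b) # clamp_params (min l b) es)"
    then have "fst x \<in> set (map fst ((k, l) # clamp_params (min l b) es))" by auto
    also have "map fst ((k, l) # clamp_params (min l b) es) = map fst (e # es)"
      by (simp only: list.map map_fst_clamp_params d fst_conv)
    finally have "fst x \<in> fst ` set (e # es)" by (simp only: set_map)
    then obtain x' where "fst x = fst x'" "x' \<in> set (e # es)" by (rule imageE)
    then show "0 \<le> c (fst x)"
      using Cons.prems(1)[of x'] by simp
  qed
  \<comment> \<open>If \<open>b < l\<close>, drafting beyond the demand \<open>b\<close> has no
    effect on \<open>gam\<close>. Lowering the demand from \<open>j\<close> to \<open>b\<close> can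
    only reduce it.\<close>
  have "gam (\<alpha> k i) (min l b) b = gam (\<alpha> k i) l b"
    by (cases "l \<le> b") (simp_all add: min_def gam_excess[of b l])
  also have "\<dots> \<le> gam (\<alpha> k i) l j"
    using Cons.prems(2) d by (intro gam_mono) simp
  finally have "gam (\<alpha> k i) (min l b) b \<le> gam (\<alpha> k i) l j" .
  moreover have "0 \<le> c i" using Cons.prems(1)[of d] d by simp
  moreover have "0 \<le> gam (\<alpha> k i) l j" using gam_ge_1[of "\<alpha> k i" l j] by linarith
  ultimately show ?case
    using le nonneg d by (auto intro!: mult_mono)
qed


lemma parcs_hsd_graph:
  "parcs (hsd_graph K Tmax) =
    {(Target, Draft i j) | i j. i < K \<and> j \<in> {1..Tmax}} \<union>
    {(Draft i j, Draft k l) | i j k l.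
      i < K \<and> k < i \<and> j \<in> {1..Tmax} \<and> l \<in> {1..Tmax} \<and> l \<le> j} \<union>
    {(Draft i j, Final i) | i j. i < K \<and> j \<in> {1..Tmax}} \<union>
    {(Final i, Final i) | i. i < K}"
  by (simp add: hsd_graph_def)

lemma pverts_hsd_graph:
  "pverts (hsd_graph K Tmax) =
    {Target} \<union> {Draft i j | i j. i < K \<and> j \<in> {1..Tmax}} \<union> {Final i | i. i < K}"
  by (simp add: hsd_graph_def)

section \<open>Augmented paths of the HSD graph\<close>

text \<open>The self-loop at the final vertex is left out: it is the closing edge of the augmented
  path.\<close>

fun draft_arcs :: "nat \<times> nat \<Rightarrow> (nat \<times> nat) list \<Rightarrow> (vertex \<times> vertex) list" where
  "draft_arcs (i, j) [] = [(Draft i j, Final i)]"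
| "draft_arcs (i, j) ((k, l) # ds) = (Draft i j, Draft k l) # draft_arcs (k, l) ds"

definition chain_arcs :: "(nat \<times> nat) list \<Rightarrow> (vertex \<times> vertex) list" where
  "chain_arcs ds =
    (Target, Draft (fst (hd ds)) (snd (hd ds))) # draft_arcs (hd ds) (tl ds)"

text \<open>An edge between drafts costs its multiplier times \<open>c i\<close>, so a step of
  \<open>path_cost\<close> factors into a Horner step; the edge to \<open>Final i\<close> supplies
  the innermost term \<open>real j * c i\<close>.\<close>

lemma path_cost_draft_arcs:
  "path_cost (hsd_mult K \<alpha>) (hsd_cost K c \<alpha>) (draft_arcs d ds) = draft_latency c \<alpha> d ds"
  by (induction d ds rule: draft_arcs.induct) (simp_all add: algebra_simps)

lemma path_cost_chain_arcs:
  "path_cost (hsd_mult K \<alpha>) (hsd_cost K c \<alpha>) (chain_arcs ds) = chain_latency K c \<alpha> ds"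
  by (simp add: chain_arcs_def chain_latency_def path_cost_draft_arcs algebra_simps)

lemma drafts_of_draft_arcs:
  "[i. Draft i j \<leftarrow> pawalk_verts u (draft_arcs d ds)] = map fst (d # ds)"
  "[j. Draft i j \<leftarrow> pawalk_verts u (draft_arcs d ds)] = map snd (d # ds)"
  by (induction d ds arbitrary: u rule: draft_arcs.induct) simp_all

lemma path_models_chain_arcs:
  "ds \<noteq> [] \<Longrightarrow> path_models K Tmax (chain_arcs ds) [] = rev (map fst ds) @ [K]"
  using drafts_of_draft_arcs(1)[of "Draft (fst (hd ds)) (snd (hd ds))" "hd ds" "tl ds"]
  by (simp add: path_models_def awalk_verts_with_proj_eq chain_arcs_def)

lemma path_params_chain_arcs:
  "ds \<noteq> [] \<Longrightarrow> path_params K Tmax (chain_arcs ds) [] = rev (map snd ds)"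
  using drafts_of_draft_arcs(2)[of "Draft (fst (hd ds)) (snd (hd ds))" "hd ds" "tl ds"]
  by (simp add: path_params_def awalk_verts_with_proj_eq chain_arcs_def)

section \<open>Acyclicity up to self-loops\<close>

fun vertex_rank :: "nat \<Rightarrow> vertex \<Rightarrow> nat" where
  "vertex_rank K Target = Suc K"
| "vertex_rank K (Draft i j) = Suc i"
| "vertex_rank K (Final i) = 0"

text \<open>Edges lead from the target to drafts, from drafts to drafts of smaller model index and
  from drafts to final vertices, so only the self-loops at final vertices fail to descend.\<close>

lemma vertex_rank_less:
  assumes "(u, v) \<in> parcs (hsd_graph K Tmax)"
  shows "vertex_rank K v < vertex_rank K u \<or> (\<exists>i. u = Final i \<and> v = Final i)"
  using assms by (auto simp: parcs_hsd_graph pverts_hsd_graph)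

locale hsd_digraph =
  fixes K Tmax :: nat
begin

sublocale pair_fin_digraph "hsd_graph K Tmax"
  \<comment> \<open>The zero rates are a placeholder: the graph itself does not depend on the
    rates.\<close>
  using gsp_instance_hsd_graph[of K "\<lambda>_ _. 0" Tmax] by (simp add: gsp_instance_def)

lemma vertex_rank_awalk:
  assumes "awalk u es v"
  shows "vertex_rank K v \<le> vertex_rank K u"
  using assms
proof (induction es arbitrary: u)
  case Nil
  then show ?case by (simp add: awalk_Nil_iff)
next
  case (Cons e es)
  then have e: "e \<in> parcs (hsd_graph K Tmax)" "fst e = u" and "vertex_rank K v \<le> vertex_rank K (snd e)"
    by (auto simp: awalk_Cons_iff)
  moreover have "vertex_rank K (snd e) \<le> vertex_rank K u"
    using vertex_rank_less[of "fst e" "snd e" K Tmax] e by auto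
  ultimately show ?case by simp
qed

text \<open>The walk from \<open>snd e\<close> to \<open>fst e\<close> cannot raise the rank, so
  \<open>e\<close> cannot lower it and is a self-loop at some \<open>Final w\<close>. Then
  \<open>q\<close> is a simple path from \<open>Final w\<close> to itself, hence empty.\<close>

lemma augmented_path_closes_at_Final:
  assumes "augmented_path (hsd_graph K Tmax) m s p q e"
  obtains w where "q = []" "e = (Final w, Final w)" "apath s p (Final w)"
proof -
  have path: "apath s (p @ q) (fst e)" "awalk s p (snd e)" "awalk (snd e) q (fst e)"
    and "cycle (q @ [e])"
    using assms unfolding augmented_path_def lossy_cycle_def by blast+
  from \<open>cycle (q @ [e])\<close> obtain u where "awalk u (q @ [e]) u"
    unfolding cycle_def by blast
  then have "e \<in> parcs (hsd_graph K Tmax)"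
    unfolding awalk_def by simp
  then have "vertex_rank K (snd e) < vertex_rank K (fst e) \<or> (\<exists>w. fst e = Final w \<and> snd e = Final w)"
    by (intro vertex_rank_less) simp
  with vertex_rank_awalk[OF path(3)] obtain w where e: "e = (Final w, Final w)"
    using prod.collapse[of e] by fastforce
  have "awlast s p = Final w"
    using awlast_of_awalk[OF path(2)] e by simp
  then have "apath (Final w) q (Final w)"
    using path(1) e by (simp add: apath_append_iff)
  then have "q = []" using apath_nonempty_ends by blast
  then show thesis using that[of w] e path by simp
qed

section \<open>Correspondence between chains and paths of the graph\<close>

lemma awalk_draft_arcs:
  assumes "chain K Tmax (d # ds)" "sorted_wrt (\<lambda>x y. snd y \<le> snd x) (d # ds)"
  shows "awalk (Draft (fst d) (snd d)) (draft_arcs d ds) (Final (fst (last (d # ds))))"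
  using assms
proof (induction d ds rule: draft_arcs.induct)
  case (1 i j)
  then show ?case
    by (auto simp: awalk_Cons_iff awalk_Nil_iff parcs_hsd_graph pverts_hsd_graph chain_def)
next
  case (2 i j k l ds)
  then have "awalk (Draft k l) (draft_arcs (k, l) ds) (Final (fst (last ((k, l) # ds))))"
    by (simp add: chain_def)
  then show ?case
    using 2(2,3) by (auto simp: awalk_Cons_iff parcs_hsd_graph pverts_hsd_graph chain_def)
qed

lemma awalk_chain_arcs:
  assumes "chain K Tmax ds" "sorted_wrt (\<lambda>x y. snd y \<le> snd x) ds" "ds \<noteq> []"
  shows "awalk Target (chain_arcs ds) (Final (fst (last ds)))"
proof -
  obtain i j es where ds: "ds = (i, j) # es" using assms(3) by (cases ds) auto
  then have "(Target, Draft i j) \<in> parcs (hsd_graph K Tmax)"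
    using assms(1) by (auto simp: chain_def parcs_hsd_graph pverts_hsd_graph)
  then show ?thesis
    using awalk_draft_arcs[of "(i, j)" es] assms ds by (simp add: awalk_Cons_iff chain_arcs_def)
qed

text \<open>The only edge leaving a final vertex is its self-loop, which would repeat the
  vertex.\<close>

lemma apath_from_Final:
  assumes "apath (Final i) es v"
  shows "es = []"
proof (cases es)
  case (Cons e es')
  then have "e \<in> parcs (hsd_graph K Tmax)" "fst e = Final i" "apath (snd e) es' v"
    and fresh: "fst e \<notin> set (pawalk_verts (snd e) es')"
    using assms by (auto simp: apath_Cons_iff)
  then have "snd e = Final i" "snd e \<in> set (pawalk_verts (snd e) es')"
    using hd_in_awalk_verts(2) by (auto simp: parcs_hsd_graph pverts_hsd_graph)
  with fresh \<open>fst e = Final i\<close> show ?thesis by simp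
qed

text \<open>A step to a draft extends the chain given by induction; after a step to a final vertex
  the simple path must stop.\<close>

lemma apath_Draft_FinalE:
  assumes "apath (Draft i j) es (Final w)"
  obtains ds where "es = draft_arcs (i, j) ds" "chain K Tmax ((i, j) # ds)"
  using assms
proof (induction es arbitrary: i j thesis)
  case Nil
  then show ?case by (simp add: apath_Nil_iff)
next
  case (Cons e es)
  then have e: "e \<in> parcs (hsd_graph K Tmax)" "fst e = Draft i j" and path: "apath (snd e) es (Final w)"
    by (auto simp: apath_Cons_iff)
  then consider (Final) "e = (Draft i j, Final i)" "i < K" "j \<in> {1..Tmax}" |
    (Draft) k l where "e = (Draft i j, Draft k l)" "i < K" "k < i" "j \<in> {1..Tmax}"
    by (auto simp: parcs_hsd_graph pverts_hsd_graph)
  then show ?case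
  proof cases
    case Final
    then show ?thesis
      using path apath_from_Final[of i es] by (intro Cons.prems(1)[of "[]"]) (auto simp: chain_def)
  next
    case Draft
    obtain ds where "es = draft_arcs (k, l) ds" "chain K Tmax ((k, l) # ds)"
      using Cons.IH[of k l] path Draft by auto
    with Draft show ?thesis
      by (intro Cons.prems(1)[of "(k, l) # ds"]) (auto simp: chain_def)
  qed
qed

lemma apath_Target_FinalE:
  assumes "apath Target es (Final w)"
  obtains ds where "ds \<noteq> []" "es = chain_arcs ds" "chain K Tmax ds"
proof (cases es)
  case Nil
  then show thesis using assms by (simp add: apath_Nil_iff)
next
  case (Cons e es')
  then have e: "e \<in> parcs (hsd_graph K Tmax)" "fst e = Target" and path: "apath (snd e) es' (Final w)"
    using assms by (auto simp: apath_Cons_iff)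
  then obtain i j where ij: "e = (Target, Draft i j)" by (auto simp: parcs_hsd_graph pverts_hsd_graph)
  then obtain ds where "es' = draft_arcs (i, j) ds" "chain K Tmax ((i, j) # ds)"
    using path apath_Draft_FinalE[of i j es' w] by auto
  then show thesis
    using that[of "(i, j) # ds"] ij Cons by (simp add: chain_arcs_def)
qed

lemma loop_at_Final:
  assumes "awalk u es (Final w)"
  shows "(Final w, Final w) \<in> parcs (hsd_graph K Tmax)"
  using awalk_last_in_verts[OF assms] by (auto simp: parcs_hsd_graph pverts_hsd_graph)

lemma hsd_mult_nonneg:
  assumes "\<And>i j. i \<le> K \<Longrightarrow> j \<le> K \<Longrightarrow> 0 \<le> \<alpha> i j \<and> \<alpha> i j \<le> 1" and "a \<in> parcs (hsd_graph K Tmax)"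
  shows "0 \<le> hsd_mult K \<alpha> a"
  using gsp_instance_hsd_graph[of K \<alpha> Tmax] assms
  by (auto simp: gsp_instance_def intro: less_imp_le)

lemma gsp_feasible_chain:
  assumes "awalk Target (chain_arcs ds) (Final w)" "\<And>i j. i \<le> K \<Longrightarrow> j \<le> K \<Longrightarrow> 0 \<le> \<alpha> i j \<and> \<alpha> i j \<le> 1"
  shows "gsp_feasible (hsd_graph K Tmax) (hsd_mult K \<alpha>) Target
      (path_flow (hsd_mult K \<alpha>) (Final w) (chain_arcs ds))"
    and "gsp_cost (hsd_graph K Tmax) (hsd_cost K c \<alpha>)
      (path_flow (hsd_mult K \<alpha>) (Final w) (chain_arcs ds)) = chain_latency K c \<alpha> ds"
proof -
  show "gsp_feasible (hsd_graph K Tmax) (hsd_mult K \<alpha>) Target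
      (path_flow (hsd_mult K \<alpha>) (Final w) (chain_arcs ds))"
    using gsp_feasible_path_flow[of Target "chain_arcs ds" "Final w" "hsd_mult K \<alpha>"]
      assms loop_at_Final[OF assms(1)] hsd_mult_nonneg[of \<alpha>] by simp
  show "gsp_cost (hsd_graph K Tmax) (hsd_cost K c \<alpha>)
      (path_flow (hsd_mult K \<alpha>) (Final w) (chain_arcs ds)) = chain_latency K c \<alpha> ds"
    using assms(1) by (subst gsp_cost_path_flow) (auto simp: awalk_def path_cost_chain_arcs)
qed

section \<open>Lower bound for flows by a dual potential\<close>

lemma finite_chains: "finite {ds. chain K Tmax ds}"
proof (rule finite_subset)
  show "{ds. chain K Tmax ds} \<subseteq> {ds. set ds \<subseteq> {..<K} \<times> {1..Tmax} \<and> distinct ds}"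
  proof clarify
    fix ds assume "chain K Tmax ds"
    \<comment> \<open>Strictly decreasing models force distinct entries, and a finite set has
      finitely many lists of distinct entries.\<close>
    then have "sorted_wrt (<) (rev (map fst ds))" "set ds \<subseteq> {..<K} \<times> {1..Tmax}"
      by (simp_all add: chain_def sorted_wrt_rev sorted_wrt_map)
    then show "set ds \<subseteq> {..<K} \<times> {1..Tmax} \<and> distinct ds"
      by (simp add: strict_sorted_iff distinct_map)
  qed
qed (simp add: finite_subset_distinct)

text \<open>The least latency of a completion is a potential: the best completion at the head of an
  arc, extended by that arc, competes at its tail. Weak duality then bounds every flow.\<close>

lemma min_chain_latency_le_gsp_cost:
  assumes "gsp_feasible (hsd_graph K Tmax) (hsd_mult K \<alpha>) Target f"
    and min: "\<And>ds. ds \<noteq> [] \<Longrightarrow> chain K Tmax ds \<Longrightarrow> x \<le> chain_latency K c \<alpha> ds"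
  shows "x \<le> gsp_cost (hsd_graph K Tmax) (hsd_cost K c \<alpha>) f"
proof -
  define S where "S = (\<lambda>i j. {ds. chain K Tmax ((i, j) # ds)})"
  \<comment> \<open>At the source \<open>x\<close> itself is the potential, and \<open>min\<close>
    gives its arc inequalities; final vertices get 0 because their loops are free.\<close>
  define h where "h = case_vertex x (\<lambda>i j. Min (draft_latency c \<alpha> (i, j) ` S i j)) (\<lambda>_. 0)"
  have fin: "finite (S i j)" for i j
  proof (rule finite_subset)
    show "S i j \<subseteq> tl ` {ds. chain K Tmax ds}"
    proof
      fix ds assume "ds \<in> S i j"
      then show "ds \<in> tl ` {ds. chain K Tmax ds}"
        by (intro image_eqI[of _ _ "(i, j) # ds"]) (simp_all add: S_def)
    qed
  qed (simp add: finite_chains)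
  have h_le: "h (Draft i j) \<le> draft_latency c \<alpha> (i, j) ds" if "chain K Tmax ((i, j) # ds)" for i j ds
    using that fin by (simp add: h_def S_def)
  have h_attained: "\<exists>ds. chain K Tmax ((i, j) # ds) \<and> h (Draft i j) = draft_latency c \<alpha> (i, j) ds"
    if "i < K" "j \<in> {1..Tmax}" for i j
  proof -
    \<comment> \<open>Stopping at once is a completion, so the minimum is over a nonempty
      set.\<close>
    have "[] \<in> S i j" using that by (simp add: S_def chain_def)
    then have "h (Draft i j) \<in> draft_latency c \<alpha> (i, j) ` S i j"
      unfolding h_def vertex.case using fin by (intro Min_in) auto
    then show ?thesis by (auto simp: S_def)
  qed
  have "h Target \<le> gsp_cost (hsd_graph K Tmax) (hsd_cost K c \<alpha>) f"
  proof (rule potential_le_gsp_cost[OF assms(1)])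
    show "Target \<in> pverts (hsd_graph K Tmax)" by (simp add: pverts_hsd_graph)
    fix u v assume uv: "(u, v) \<in> parcs (hsd_graph K Tmax)"
    then consider
      (Target) i j where "u = Target" "v = Draft i j" "i < K" "j \<in> {1..Tmax}"
      | (Draft) i j k l where "u = Draft i j" "v = Draft k l" "i < K" "k < i"
          "j \<in> {1..Tmax}" "l \<in> {1..Tmax}"
      | (Final) i j where "u = Draft i j" "v = Final i" "i < K" "j \<in> {1..Tmax}"
      | (loop) i where "u = Final i" "v = Final i"
      by (auto simp: parcs_hsd_graph pverts_hsd_graph)
    then show "h u \<le> hsd_cost K c \<alpha> (u, v) + hsd_mult K \<alpha> (u, v) * h v"
    proof cases
      case Target
      then obtain ds where "chain K Tmax ((i, j) # ds)" "h v = draft_latency c \<alpha> (i, j) ds"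
        using h_attained by blast
      then show ?thesis
        using min[of "(i, j) # ds"] Target by (simp add: chain_latency_def h_def algebra_simps)
    next
      case Draft
      then obtain ds where ds: "chain K Tmax ((k, l) # ds)" "h v = draft_latency c \<alpha> (k, l) ds"
        using h_attained[of k l] by auto
      then have "chain K Tmax ((i, j) # (k, l) # ds)"
        using Draft by (auto simp: chain_def)
      from h_le[OF this] show ?thesis
        using Draft ds(2) by (simp add: algebra_simps)
    next
      case Final
      then show ?thesis using h_le[of i j "[]"] by (simp add: chain_def h_def)
    next
      case loop
      then show ?thesis by (simp add: h_def)
    qed
  qed
  then show ?thesis by (simp add: h_def)
qed

end

theorem theorem3p7:
  fixes K Tmax :: nat
    and c :: "nat \<Rightarrow> real"
    and \<alpha> :: "nat \<Rightarrow> nat \<Rightarrow> real"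
    and p q :: "(vertex \<times> vertex) list"
    and e :: "vertex \<times> vertex"
  assumes "1 \<le> K" and "1 \<le> Tmax"
    and "\<And>i. i \<le> K \<Longrightarrow> 0 < c i"
    and "\<And>i j. i \<le> K \<Longrightarrow> j \<le> K \<Longrightarrow> 0 \<le> \<alpha> i j \<and> \<alpha> i j \<le> 1"
    and "augmented_path (hsd_graph K Tmax) (hsd_mult K \<alpha>) Target p q e"
  shows "gsp_solution (hsd_graph K Tmax) (hsd_mult K \<alpha>) (hsd_cost K c \<alpha>) Target p q e
    \<longleftrightarrow> hsd_optimal K Tmax c \<alpha> (path_models K Tmax p q) (path_params K Tmax p q)"
proof -
  interpret hsd_digraph K Tmax .
  let ?G = "hsd_graph K Tmax" and ?m = "hsd_mult K \<alpha>" and ?c = "hsd_cost K c \<alpha>"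
  let ?cost = "gsp_cost ?G ?c"
  obtain w where q: "q = []" and e: "e = (Final w, Final w)" and path: "apath Target p (Final w)"
    using augmented_path_closes_at_Final[OF assms(5)] .
  obtain ds where ds: "ds \<noteq> []" "chain K Tmax ds" and p: "p = chain_arcs ds"
    using apath_Target_FinalE[OF path] .
  have walk: "awalk Target (chain_arcs ds) (Final w)"
    using path p by (simp add: awalkI_apath)
  from walk assms(4) have feasible: "gsp_feasible ?G ?m Target (path_flow ?m (Final w) (chain_arcs ds))"
    and cost: "?cost (path_flow ?m (Final w) (chain_arcs ds)) = chain_latency K c \<alpha> ds"
    using gsp_feasible_chain(1)[of ds w \<alpha>] gsp_feasible_chain(2)[of ds w \<alpha> c] by blast+
  have loop: "(Final w, Final w) \<in> parcs ?G" using walk by (rule loop_at_Final)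
  have pos: "0 \<le> ?m a" if "a \<in> parcs ?G" for a
    using hsd_mult_nonneg[of \<alpha>] assms(4) that by blast
  have "augmented_path_flow ?G ?m Target p q e = path_flow ?m (Final w) (chain_arcs ds)"
    using augmented_path_flow_loop[of Target p "Final w" ?m] path loop pos q e p by simp
  then have "gsp_solution ?G ?m ?c Target p q e \<longleftrightarrow>
      (\<forall>f. gsp_feasible ?G ?m Target f \<longrightarrow> chain_latency K c \<alpha> ds \<le> ?cost f)"
    using assms(5) feasible cost by (simp add: gsp_solution_def gsp_optimal_def)
  also have "\<dots> \<longleftrightarrow>
      (\<forall>es. es \<noteq> [] \<longrightarrow> chain K Tmax es \<longrightarrow> chain_latency K c \<alpha> ds \<le> chain_latency K c \<alpha> es)"
  proof (intro iffI allI impI)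
    fix es assume opt: "\<forall>f. gsp_feasible ?G ?m Target f \<longrightarrow> chain_latency K c \<alpha> ds \<le> ?cost f"
      and es: "es \<noteq> []" "chain K Tmax es"
    obtain i j xs where es_eq: "es = (i, j) # xs" using es(1) by (cases es) auto
    \<comment> \<open>Clamping at the parameter of its own first draft leaves that draft, and hence
      the target rate, unchanged, and makes the chain a path of the graph.\<close>
    let ?es = "clamp_params j es"
    have i: "i < K" "1 \<le> j" and j: "?es = (i, j) # clamp_params j xs"
      using es es_eq by (auto simp: chain_def)
    have "awalk Target (chain_arcs ?es) (Final (fst (last ?es)))"
      using awalk_chain_arcs[of ?es] chain_clamp_params[OF es(2) i(2)] sorted_clamp_params[of j es] j by simp
    with assms(4) have "gsp_feasible ?G ?m Target
        (path_flow ?m (Final (fst (last ?es))) (chain_arcs ?es))"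
      and cost: "?cost (path_flow ?m (Final (fst (last ?es))) (chain_arcs ?es)) =
        chain_latency K c \<alpha> ?es"
      using gsp_feasible_chain(1)[of ?es "fst (last ?es)" \<alpha>]
        gsp_feasible_chain(2)[of ?es "fst (last ?es)" \<alpha> c] by blast+
    then have "chain_latency K c \<alpha> ds \<le> chain_latency K c \<alpha> ?es"
      using opt unfolding cost[symmetric] by blast
    also have "\<dots> \<le> chain_latency K c \<alpha> es"
    proof -
      have "0 \<le> c (fst x)" if "x \<in> set ((i, j) # xs)" for x
      proof -
        have "x \<in> {..<K} \<times> {1..Tmax}"
          using es(2) es_eq that unfolding chain_def by blast
        then have "fst x \<in> {..<K}" by (rule mem_Times_iff[THEN iffD1, THEN conjunct1])
        then show ?thesis using assms(3)[of "fst x"] by simp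
      qed
      then have "draft_latency c \<alpha> (i, j) (clamp_params j xs) \<le> draft_latency c \<alpha> (i, j) xs"
        using draft_latency_clamp_params_le[of "(i, j)" xs c j] by simp
      moreover have "0 \<le> target_rate (\<alpha> i K) j"
        using assms(4)[of i K] i target_rate_pos[of "\<alpha> i K" j] by simp
      ultimately show ?thesis
        by (simp add: chain_latency_def j es_eq mult_left_mono)
    qed
    finally show "chain_latency K c \<alpha> ds \<le> chain_latency K c \<alpha> es" .
  next
    \<comment> \<open>The latency of \<open>ds\<close> is here a lower bound for all chains, so it
      may serve as the potential of the source.\<close>
    fix f assume "\<forall>es. es \<noteq> [] \<longrightarrow> chain K Tmax es \<longrightarrow> chain_latency K c \<alpha> ds \<le> chain_latency K c \<alpha> es"
      and "gsp_feasible ?G ?m Target f"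
    then show "chain_latency K c \<alpha> ds \<le> ?cost f"
      using min_chain_latency_le_gsp_cost[of \<alpha> f "chain_latency K c \<alpha> ds" c] by blast
  qed
  also have "\<dots> \<longleftrightarrow> hsd_optimal K Tmax c \<alpha> (path_models K Tmax p q) (path_params K Tmax p q)"
    unfolding p q path_models_chain_arcs[OF ds(1)] path_params_chain_arcs[OF ds(1)]
    by (rule hsd_optimal_iff_chain[OF ds, symmetric])
  finally show ?thesis .
qed

end
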